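(* Let $X$ be a minimal shift space on a finite alphabet $A$ and $\varphi\colon A^*\to G$ be a (monoid) morphism onto a finite group $G$. The following conditions are equivalent. (i) For every $n>0$ and $x\in X$, $\{\varphi(x_{[0,m)})\mid m\in\mathbb N,\ x_{[m,m+n)}=x_{[0,n)}\}=G$. (ii) The skew product $G\rtimes_\varphi X$ is minimal. (iii) For every $u\in\mathcal L(X)$, the restriction of $\varphi$ to $\mathcal R_X(u)^*$ is surjective onto $G$.
   Context: A shift space on a finite alphabet $A$ is a nonempty closed subset $X\subseteq A^{\mathbb Z}$ invariant under the shift map $S((x_n)_n)=(x_{n+1})_n$, such that every letter of $A$ occurs in some element of $X$; it is minimal if it has no proper nonempty closed shift-invariant subset. Write $x_{[i,j)}=x_i\cdots x_{j-1}$. The language $\mathcal L(X)$ is the set of all finite words $x_{[i,j)}$, $x\in X$, $i\le j$. For $w\in\mathcal L(X)$, the set $\mathcal R_X(w)$ of (right) return words to $w$ is the set of nonempty words $r\in A^*$ such that $rw\in\mathcal L(X)$ and $rw$ has exactly two occurrences of $w$ as a factor, one as a prefix and one as a suffix. $\mathcal R_X(u)^*$ is the submonoid of $A^*$ generated by $\mathcal R_X(u)$. The skew product $G\rtimes_\varphi X$ is the dynamical system $(G\times X,T_\varphi)$, $G$ discrete, with $T_\varphi(g,x)=(g\varphi(x_0),Sx)$; it is minimal if it has no proper nonempty closed $T_\varphi$-invariant subset. *)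

theory Defs
  imports "HOL-Analysis.Analysis" "HOL-Algebra.Group" "HOL-Library.Sublist"
begin

definition full_shift :: "'a set \<Rightarrow> (int \<Rightarrow> 'a) topology" where
  "full_shift A = product_topology (\<lambda>_. discrete_topology A) UNIV"

definition shift :: "(int \<Rightarrow> 'a) \<Rightarrow> (int \<Rightarrow> 'a)" where
  "shift x = (\<lambda>n. x (n + 1))"

definition shift_space :: "'a set \<Rightarrow> (int \<Rightarrow> 'a) set \<Rightarrow> bool" where
  "shift_space A X \<longleftrightarrow>
     X \<noteq> {} \<and> closedin (full_shift A) X \<and> shift ` X = X \<and> (\<forall>a\<in>A. \<exists>x\<in>X. \<exists>n. x n = a)"

text \<open>Invariance of \<open>Y\<close> means \<open>T(Y) = Y\<close>. The lemma \<open>minimal_system_iff_forward\<close> below shows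
  that requiring only \<open>T(Y) \<subseteq> Y\<close> gives the same notion of minimality for continuous injective
  maps of compact Hausdorff spaces.\<close>

definition minimal_system :: "'b topology \<Rightarrow> ('b \<Rightarrow> 'b) \<Rightarrow> bool" where
  "minimal_system U T \<longleftrightarrow>
     (\<forall>Y. closedin U Y \<and> Y \<noteq> {} \<and> T ` Y = Y \<longrightarrow> Y = topspace U)"

definition minimal_shift_space :: "'a set \<Rightarrow> (int \<Rightarrow> 'a) set \<Rightarrow> bool" where
  "minimal_shift_space A X \<longleftrightarrow>
     shift_space A X \<and> minimal_system (subtopology (full_shift A) X) shift"

text \<open>The word \<open>x\<^bsub>[i,j)\<^esub>\<close>.\<close>

definition word :: "(int \<Rightarrow> 'a) \<Rightarrow> int \<Rightarrow> int \<Rightarrow> 'a list" where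
  "word x i j = map x [i..j - 1]"

definition language :: "(int \<Rightarrow> 'a) set \<Rightarrow> 'a list set" where
  "language X = {word x i j | x i j. x \<in> X \<and> i \<le> j}"

definition occurrences :: "'a list \<Rightarrow> 'a list \<Rightarrow> nat set" where
  "occurrences w v = {i. \<exists>p s. v = p @ w @ s \<and> length p = i}"

definition return_words :: "(int \<Rightarrow> 'a) set \<Rightarrow> 'a list \<Rightarrow> 'a list set" where
  "return_words X w =
     {r. r \<noteq> [] \<and> r @ w \<in> language X \<and> card (occurrences w (r @ w)) = 2 \<and>
         prefix w (r @ w) \<and> suffix w (r @ w)}"

definition free_monoid :: "'a set \<Rightarrow> 'a list monoid" where
  "free_monoid A = \<lparr>carrier = lists A, mult = (@), one = []\<rparr>"

definition submonoid_generated :: "('b, 'm) monoid_scheme \<Rightarrow> 'b set \<Rightarrow> 'b set" where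
  "submonoid_generated M R = (\<lambda>H. submonoid H M) hull R"

definition skew_topology ::
    "('g, 'm) monoid_scheme \<Rightarrow> 'a set \<Rightarrow> (int \<Rightarrow> 'a) set \<Rightarrow> ('g \<times> (int \<Rightarrow> 'a)) topology" where
  "skew_topology G A X =
     prod_topology (discrete_topology (carrier G)) (subtopology (full_shift A) X)"

definition skew_map ::
    "('g, 'm) monoid_scheme \<Rightarrow> ('a list \<Rightarrow> 'g) \<Rightarrow> 'g \<times> (int \<Rightarrow> 'a) \<Rightarrow> 'g \<times> (int \<Rightarrow> 'a)" where
  "skew_map G \<phi> = (\<lambda>(g, x). (g \<otimes>\<^bsub>G\<^esub> \<phi> [x 0], shift x))"

lemma minimal_system_iff_forward:
  assumes comp: "compact_space U" and haus: "Hausdorff_space U"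
    and cont: "continuous_map U U T" and inj: "inj_on T (topspace U)"
  shows "minimal_system U T \<longleftrightarrow>
           (\<forall>Y. closedin U Y \<and> Y \<noteq> {} \<and> T ` Y \<subseteq> Y \<longrightarrow> Y = topspace U)"
proof
  assume min: "minimal_system U T"
  show "\<forall>Y. closedin U Y \<and> Y \<noteq> {} \<and> T ` Y \<subseteq> Y \<longrightarrow> Y = topspace U"
  proof (intro allI impI, elim conjE)
    fix Y assume Y: "closedin U Y" "Y \<noteq> {}" "T ` Y \<subseteq> Y"
    define C where "C n = (T ^^ n) ` Y" for n
    have CS: "C (Suc n) = T ` C n" for n by (simp add: C_def image_comp)
    have cm: "closed_map U U T"
      using comp cont haus by (simp add: continuous_imp_closed_map)
    have C0: "C 0 = Y" by (simp add: C_def)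
    have clC: "closedin U (C n)" for n
    proof (induction n)
      case 0 show ?case using Y(1) C0 by simp
    next
      case (Suc n) then show ?case using cm CS unfolding closed_map_def by simp
    qed
    have dec: "C (Suc n) \<subseteq> C n" for n
    proof (induction n)
      case 0 show ?case using Y(3) C0 CS[of 0] by simp
    next
      case (Suc n) then show ?case using CS by (metis image_mono)
    qed
    have decs: "decseq C" using dec by (simp add: decseq_Suc_iff)
    define Z where "Z = (\<Inter>n. C n)"
    have "C n \<noteq> {}" for n using Y(2) by (simp add: C_def)
    then have Zne: "Z \<noteq> {}"
      unfolding Z_def using compact_space_imp_nest[OF comp clC _ decs] by blast
    have clZ: "closedin U Z" unfolding Z_def using clC by (intro closedin_Inter) auto
    have "Z \<subseteq> Y" unfolding Z_def using C0 by blast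
    have "T ` Z = (\<Inter>n. T ` C n)"
      unfolding Z_def using inj clC closedin_subset
      by (intro image_INT[of T "topspace U" UNIV C 0]) (simp_all add: closedin_subset)
    also have "\<dots> = (\<Inter>n. C (Suc n))" by (simp add: CS)
    also have "\<dots> = Z" unfolding Z_def using dec by blast
    finally have "T ` Z = Z" .
    then have "Z = topspace U" using min clZ Zne unfolding minimal_system_def by blast
    with \<open>Z \<subseteq> Y\<close> closedin_subset[OF Y(1)] show "Y = topspace U" by blast
  qed
qed (auto simp: minimal_system_def)

end

theory Submission
  imports Defs
begin

text \<open>The implications are proved in the cycle (ii), (i), (iii), (ii). If the skew product is minimal,
  then the forward orbit of \<open>(1, x)\<close> is dense, and its visits to \<open>{g} \<times> [x\<^bsub>[0,n)\<^esub>]\<close> give (i).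
  A word \<open>x\<^bsub>[0,m)\<^esub>\<close> between two occurrences of \<open>u\<close> factors into return words to \<open>u\<close>, so
  (i) gives (iii). For the last implication let \<open>Y\<close> be closed and invariant, with fibers
  \<open>Y\<^sub>x = {g. (g, x) \<in> Y}\<close>. The cardinality of \<open>Y\<^sub>x\<close> is upper semicontinuous and shift
  invariant, hence constant by minimality of \<open>X\<close>; therefore \<open>Y\<^sub>x\<close> itself is locally constant, so
  it equals some fixed \<open>Q\<close> on the cylinder of a long word \<open>u\<close>. Then \<open>Q\<close> is stable under right
  multiplication by the images of the return words to \<open>u\<close>, which generate \<open>G\<close>, so \<open>Q = G\<close>.\<close>

section \<open>Words\<close>

text \<open>Trades the integer interval for natural indices, so that length and \<open>nth\<close>
  compute. Later words are therefore written with right end \<open>i + int n\<close>, even when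
  \<open>i\<close> is 0.\<close>

lemma word_conv_map_upt: "word x i (i + int n) = map (\<lambda>k. x (i + int k)) [0..<n]"
  by (rule nth_equalityI) (auto simp: word_def nth_upto)

lemma length_word [simp]: "length (word x i (i + int n)) = n"
  by (simp add: word_conv_map_upt)

lemma word_self [simp]: "word x i i = []"
  by (simp add: word_def)

lemma word_eq_iff:
  "word x i (i + int n) = word y j (j + int n) \<longleftrightarrow> (\<forall>k<n. x (i + int k) = y (j + int k))"
  by (auto simp: word_conv_map_upt)

lemma word_append:
  "word x i (i + int m) @ word x (i + int m) (i + int m + int n) = word x i (i + int m + int n)"
proof -
  have "word x i (i + int (m + n)) = word x i (i + int m) @ word x (i + int m) (i + int m + int n)"
    by (rule nth_equalityI) (auto simp: word_conv_map_upt nth_append simp del: of_nat_add)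
  then show ?thesis by (simp add: add.assoc)
qed

lemma word_translate: "word (\<lambda>n. x (n + k)) i j = word x (i + k) (j + k)"
  by (rule nth_equalityI) (auto simp: word_def nth_upto algebra_simps)

lemma inj_shift: "inj shift"
proof (rule injI)
  fix x y :: "int \<Rightarrow> 'a" assume "shift x = shift y"
  then have "x ((n - 1) + 1) = y ((n - 1) + 1)" for n unfolding shift_def by (rule fun_cong)
  then show "x = y" by auto
qed

text \<open>Factorisations around a word become positions in a point, which is how the occurrences
  counted in \<open>return_words\<close> are controlled. The bound \<open>k + n \<le> m\<close>
  keeps the occurrence inside the window.\<close>

lemma occurrences_word:
  "occurrences (word x i (i + int n)) (word y j (j + int m)) =
     {k. k + n \<le> m \<and> word y (j + int k) (j + int k + int n) = word x i (i + int n)}"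
  (is "?L = ?R")
proof (intro equalityI subsetI)
  fix k assume "k \<in> ?L"
  then obtain p s where eq: "word y j (j + int m) = p @ word x i (i + int n) @ s" and k: "length p = k"
    by (auto simp: occurrences_def)
  from arg_cong[OF eq, of length] k have len: "m = k + (n + length s)" by simp
  have "word y j (j + int m) = word y j (j + int k) @
      word y (j + int k) (j + int k + int n) @
      word y (j + int k + int n) (j + int k + int n + int (length s))"
    unfolding word_append using word_append[of y j k "n + length s"] len by (simp add: add.assoc)
  with eq k len show "k \<in> ?R" by auto
next
  fix k assume k: "k \<in> ?R"
  then obtain l where l: "m = k + (n + l)" by (auto simp: le_iff_add add.assoc)
  have "word y j (j + int m) = word y j (j + int k) @
      word y (j + int k) (j + int k + int n) @
      word y (j + int k + int n) (j + int k + int n + int l)"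
    unfolding word_append using word_append[of y j k "n + l"] l by (simp add: add.assoc)
  with k have "word y j (j + int m) = word y j (j + int k) @ word x i (i + int n) @
      word y (j + int k + int n) (j + int k + int n + int l)" by simp
  then show "k \<in> ?L" unfolding occurrences_def using length_word by blast
qed

lemma language_word: "x \<in> X \<Longrightarrow> word x i (i + int n) \<in> language X"
  unfolding language_def by force

lemma languageE:
  assumes "u \<in> language X"
  obtains x i n where "x \<in> X" "u = word x i (i + int n)"
proof -
  from assms obtain x i j where "x \<in> X" "u = word x i j" "i \<le> j" by (auto simp: language_def)
  then show thesis using that[of x i "nat (j - i)"] by simp
qed

section \<open>Generated submonoids and factorisation into return words\<close>

lemma submonoid_lists: "submonoid (lists A) (free_monoid A)"
  by unfold_locales (auto simp: free_monoid_def)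

lemma submonoid_generated_least:
  assumes "R \<subseteq> H" "submonoid H M"
  shows "submonoid_generated M R \<subseteq> H"
  unfolding submonoid_generated_def using assms by (simp add: hull_minimal)

lemma submonoid_generated_inc: "R \<subseteq> submonoid_generated M R"
  unfolding submonoid_generated_def by (rule hull_subset)

text \<open>The hull is an intersection, so membership is checked in each submonoid containing
  \<open>R\<close>.\<close>

lemma Nil_in_generated: "[] \<in> submonoid_generated (free_monoid A) R"
  unfolding submonoid_generated_def hull_def
  using submonoid.one_closed by (fastforce simp: free_monoid_def)

lemma append_in_generated:
  assumes "v \<in> submonoid_generated (free_monoid A) R" "w \<in> submonoid_generated (free_monoid A) R"
  shows "v @ w \<in> submonoid_generated (free_monoid A) R"
  using assms unfolding submonoid_generated_def hull_def
  using submonoid.m_closed[of _ "free_monoid A"] by (fastforce simp: free_monoid_def)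

text \<open>The word splits at the first return to \<open>u\<close>.\<close>

lemma word_in_generated_return_words:
  assumes "x \<in> X"
    and "word x i (i + int n) = u" and "word x (i + int m) (i + int m + int n) = u"
  shows "word x i (i + int m) \<in> submonoid_generated (free_monoid A) (return_words X u)"
  using assms(2,3)
proof (induction m arbitrary: i rule: less_induct)
  case (less m)
  show ?case
  proof (cases "m = 0")
    case True then show ?thesis by (simp add: Nil_in_generated)
  next
    case False
    define P where "P k \<longleftrightarrow> 0 < k \<and> word x (i + int k) (i + int k + int n) = u" for k
    define k where "k = (LEAST k. P k)"
    have Pm: "P m" using False less.prems by (simp add: P_def)
    then have Pk: "P k" unfolding k_def by (rule LeastI)
    have km: "k \<le> m" using Pm unfolding k_def by (rule Least_le)
    have least: "k \<le> l" if "P l" for l using that unfolding k_def by (rule Least_le)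
    have rw: "word x i (i + int k) @ u = word x i (i + int (k + n))"
      using Pk word_append[of x i k n] by (simp add: P_def add.assoc)
    \<comment> \<open>Position 0 is the given occurrence. Minimality of \<open>k\<close> excludes
      positions strictly between 0 and \<open>k\<close>, and the total length \<open>k + n\<close>
      excludes larger ones. As \<open>k\<close> is positive, exactly two remain.\<close>
    have "occurrences u (word x i (i + int k) @ u) = {0, k}"
    proof -
      have "occurrences u (word x i (i + int (k + n))) =
          {l. l + n \<le> k + n \<and> word x (i + int l) (i + int l + int n) = u}"
        using occurrences_word[of x i n x i "k + n"] less.prems(1) by simp
      also have "\<dots> = {0, k}"
        using less.prems(1) Pk least by (fastforce simp: P_def)
      finally show ?thesis by (simp only: rw)
    qed
    moreover from this have "0 \<in> occurrences u (word x i (i + int k) @ u)" by simp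
    then have "prefix u (word x i (i + int k) @ u)" by (auto simp: occurrences_def prefix_def)
    moreover have "word x i (i + int k) \<noteq> []"
      using Pk length_word[of x i k] by (auto simp: P_def simp del: length_word)
    moreover have "word x i (i + int k) @ u \<in> language X"
      unfolding rw by (rule language_word[OF assms(1)])
    ultimately have "word x i (i + int k) \<in> return_words X u"
      using Pk by (simp add: return_words_def suffix_def P_def)
    \<comment> \<open>The rest again runs from one occurrence of \<open>u\<close> to another and is
      shorter because \<open>k\<close> is positive.\<close>
    moreover have "word x (i + int k) (i + int k + int (m - k))
        \<in> submonoid_generated (free_monoid A) (return_words X u)"
    proof (rule less.IH)
      have "i + int k + int (m - k) = i + int m" using km by simp
      then show "word x (i + int k + int (m - k)) (i + int k + int (m - k) + int n) = u"
        using less.prems(2) by simp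
      show "m - k < m" using Pk km by (simp add: P_def)
      show "word x (i + int k) (i + int k + int n) = u" using Pk unfolding P_def by blast
    qed
    ultimately have "word x i (i + int k) @ word x (i + int k) (i + int k + int (m - k))
        \<in> submonoid_generated (free_monoid A) (return_words X u)"
      by (rule append_in_generated[OF subsetD[OF submonoid_generated_inc]])
    then show ?thesis using km unfolding word_append by simp
  qed
qed

section \<open>Cylinder neighbourhoods\<close>

text \<open>For a fixed point \<open>x\<close>, these centred windows give a neighbourhood basis at
  \<open>x\<close> in the full shift; all later topological arguments use them.\<close>

definition agree :: "nat \<Rightarrow> (int \<Rightarrow> 'a) \<Rightarrow> (int \<Rightarrow> 'a) \<Rightarrow> bool" where
  "agree N x y \<longleftrightarrow> (\<forall>i. \<bar>i\<bar> \<le> int N \<longrightarrow> x i = y i)"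

lemma agree_refl: "agree N x x" by (simp add: agree_def)

lemma agree_mono: "agree N x y \<Longrightarrow> M \<le> N \<Longrightarrow> agree M x y" by (simp add: agree_def)

lemma topspace_full_shift: "topspace (full_shift A) = {x. range x \<subseteq> A}"
  by (auto simp: full_shift_def PiE_def Pi_def)

text \<open>A basic open set of the product restricts only finitely many coordinates, and
  \<open>N\<close> bounds their absolute values.\<close>

lemma openin_full_shift_cylinder:
  assumes "openin (full_shift A) V" "x \<in> V"
  shows "\<exists>N. \<forall>y\<in>topspace (full_shift A). agree N x y \<longrightarrow> y \<in> V"
proof -
  obtain U where fin: "finite {i. U i \<noteq> A}" and U: "x \<in> Pi\<^sub>E UNIV U" "Pi\<^sub>E UNIV U \<subseteq> V"
    using assms unfolding full_shift_def openin_product_topology_alt by auto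
  obtain N where N: "\<forall>i\<in>{i. U i \<noteq> A}. nat \<bar>i\<bar> \<le> N"
    using finite_nat_set_iff_bounded_le[of "(\<lambda>i. nat \<bar>i\<bar>) ` {i. U i \<noteq> A}"] fin by auto
  have "y \<in> V" if "y \<in> topspace (full_shift A)" "agree N x y" for y
  proof -
    have "y i \<in> U i" for i
    proof (cases "U i = A")
      case True then show ?thesis using that(1) by (auto simp: topspace_full_shift)
    next
      case False
      then have "x i = y i" using N that(2) by (auto simp: agree_def)
      then show ?thesis using U(1) by (metis PiE_mem UNIV_I)
    qed
    then show ?thesis using U(2) by auto
  qed
  then show ?thesis by blast
qed

lemma openin_full_shift_agree: "openin (full_shift A) {y \<in> topspace (full_shift A). agree N x y}"
proof -
  \<comment> \<open>Intersecting with \<open>A\<close> makes each factor open in the discrete space;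
    if some \<open>x i\<close> in the window lies outside \<open>A\<close>, both sets are
    empty.\<close>
  define U where "U i = (if \<bar>i\<bar> \<le> int N then {x i} \<inter> A else A)" for i
  have "{i. U i \<noteq> A} \<subseteq> {- int N..int N}" by (auto simp: U_def split: if_splits)
  then have "finite {i. U i \<noteq> A}" by (rule finite_subset) simp
  then have "openin (full_shift A) (Pi\<^sub>E UNIV U)"
    unfolding full_shift_def by (intro product_topology_basis) (auto simp: U_def)
  moreover have "Pi\<^sub>E UNIV U = {y \<in> topspace (full_shift A). agree N x y}"
    by (force simp: U_def topspace_full_shift agree_def PiE_def Pi_def split: if_splits)
  ultimately show ?thesis by simp
qed

lemma openin_shift_space_iff:
  assumes "X \<subseteq> topspace (full_shift A)"
  shows "openin (subtopology (full_shift A) X) V \<longleftrightarrow>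
     V \<subseteq> X \<and> (\<forall>x\<in>V. \<exists>N. \<forall>y\<in>X. agree N x y \<longrightarrow> y \<in> V)" (is "?L \<longleftrightarrow> ?R")
proof
  assume ?L
  then obtain W where W: "openin (full_shift A) W" "V = W \<inter> X" by (auto simp: openin_subtopology)
  show ?R using openin_full_shift_cylinder[OF W(1)] W(2) assms by blast
next
  assume R: ?R
  show ?L
  proof (subst openin_subopen, intro ballI)
    fix x assume x: "x \<in> V"
    with R obtain N where N: "\<forall>y\<in>X. agree N x y \<longrightarrow> y \<in> V" by blast
    let ?W = "{y \<in> topspace (full_shift A). agree N x y} \<inter> X"
    have "openin (subtopology (full_shift A) X) ?W"
      using openin_full_shift_agree openin_subtopology by blast
    moreover have "x \<in> ?W" using x R assms agree_refl by blast
    ultimately show "\<exists>T. openin (subtopology (full_shift A) X) T \<and> x \<in> T \<and> T \<subseteq> V" using N by blast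
  qed
qed

text \<open>Since the group is discrete, a neighbourhood of \<open>(g, x)\<close> can keep
  \<open>g\<close> fixed and vary only the point.\<close>

lemma openin_skew_iff:
  assumes "X \<subseteq> topspace (full_shift A)"
  shows "openin (skew_topology G A X) W \<longleftrightarrow>
     W \<subseteq> carrier G \<times> X \<and> (\<forall>(g, x)\<in>W. \<exists>N. \<forall>y\<in>X. agree N x y \<longrightarrow> (g, y) \<in> W)"
    (is "?L \<longleftrightarrow> ?R")
proof
  assume L: ?L
  have "\<exists>N. \<forall>y\<in>X. agree N x y \<longrightarrow> (g, y) \<in> W" if gx: "(g, x) \<in> W" for g x
  proof -
    obtain U V where V: "openin (subtopology (full_shift A) X) V" "x \<in> V"
      and UV: "g \<in> U" "U \<times> V \<subseteq> W"
      using L[unfolded skew_topology_def openin_prod_topology_alt, rule_format, OF gx] by metis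
    obtain N where "\<forall>y\<in>X. agree N x y \<longrightarrow> y \<in> V"
      using V unfolding openin_shift_space_iff[OF assms] by metis
    then show ?thesis using UV by blast
  qed
  moreover have "W \<subseteq> carrier G \<times> X"
    using openin_subset[OF L] by (auto simp: skew_topology_def)
  ultimately show ?R by blast
next
  assume R: ?R
  show ?L unfolding skew_topology_def openin_prod_topology_alt
  proof (intro allI impI)
    fix g x assume gx: "(g, x) \<in> W"
    have "openin (subtopology (full_shift A) X) {y. (g, y) \<in> W}"
      unfolding openin_shift_space_iff[OF assms] using R by fastforce
    moreover have "openin (discrete_topology (carrier G)) {g}" using R gx by auto
    ultimately show "\<exists>U V. openin (discrete_topology (carrier G)) U \<and>
       openin (subtopology (full_shift A) X) V \<and> g \<in> U \<and> x \<in> V \<and> U \<times> V \<subseteq> W"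
      using gx by blast
  qed
qed

section \<open>The skew product\<close>

locale skew_product = group G for G :: "('g, 'm) monoid_scheme" (structure) +
  fixes A :: "'a set" and X :: "(int \<Rightarrow> 'a) set" and \<phi> :: "'a list \<Rightarrow> 'g"
  assumes finite_A: "finite A" and finite_G: "finite (carrier G)"
    and minimal: "minimal_shift_space A X"
    and epi: "\<phi> \<in> epi (free_monoid A) G" and \<phi>_Nil: "\<phi> [] = \<one>"
begin

lemma X_subset: "X \<subseteq> topspace (full_shift A)"
  using minimal closedin_subset unfolding minimal_shift_space_def shift_space_def by blast

lemma X_in_A: "x \<in> X \<Longrightarrow> x i \<in> A"
  using X_subset by (auto simp: topspace_full_shift)

lemma word_in_lists: "x \<in> X \<Longrightarrow> word x i j \<in> lists A"
  by (auto simp: word_def X_in_A)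

lemma shift_image: "shift ` X = X"
  using minimal by (simp add: minimal_shift_space_def shift_space_def)

text \<open>Negative translations come from surjectivity of the shift on \<open>X\<close>: a
  preimage of a translate is determined coordinatewise, hence is the next translate to the
  left.\<close>

lemma translate_in_X: "x \<in> X \<Longrightarrow> (\<lambda>n. x (n + k)) \<in> X"
proof (induction k rule: int_induct[where k = 0])
  case base then show ?case by simp
next
  case (step1 i)
  then have "shift (\<lambda>n. x (n + i)) \<in> X" using shift_image by blast
  then show ?case by (simp add: shift_def algebra_simps)
next
  case (step2 i)
  then obtain y where y: "y \<in> X" "shift y = (\<lambda>n. x (n + i))" using shift_image by (metis imageE)
  have "y n = x (n + (i - 1))" for n
    using fun_cong[OF y(2), of "n - 1"] by (simp add: shift_def algebra_simps)
  with y(1) show ?case by (metis ext)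
qed

lemma \<phi>_closed: "w \<in> lists A \<Longrightarrow> \<phi> w \<in> carrier G"
  using epi by (auto simp: epi_def hom_def free_monoid_def)

lemma \<phi>_append: "v \<in> lists A \<Longrightarrow> w \<in> lists A \<Longrightarrow> \<phi> (v @ w) = \<phi> v \<otimes> \<phi> w"
  using epi by (auto simp: epi_def hom_def free_monoid_def)

lemma topspace_skew: "topspace (skew_topology G A X) = carrier G \<times> X"
  using X_subset by (auto simp: skew_topology_def)

lemma skew_map_in: "p \<in> carrier G \<times> X \<Longrightarrow> skew_map G \<phi> p \<in> carrier G \<times> X"
  using shift_image X_in_A by (auto simp: skew_map_def \<phi>_closed)

lemma word_Suc: "word x i (i + int (Suc m)) = word x i (i + int m) @ [x (i + int m)]"
  by (simp add: word_conv_map_upt del: of_nat_Suc)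

text \<open>Each iteration multiplies by the image of the next letter, and multiplicativity of
  \<phi> collects these factors. This links orbits of the skew product to the values in (i).\<close>

lemma funpow_skew_map:
  assumes "g \<in> carrier G" "x \<in> X"
  shows "(skew_map G \<phi> ^^ m) (g, x) = (g \<otimes> \<phi> (word x 0 (int m)), \<lambda>n. x (n + int m))"
proof (induction m)
  case 0 then show ?case using assms by (simp add: \<phi>_Nil)
next
  case (Suc m)
  have "\<phi> (word x 0 (int (Suc m))) = \<phi> (word x 0 (int m)) \<otimes> \<phi> [x (int m)]"
    using word_Suc[of x 0 m] \<phi>_append[of "word x 0 (int m)" "[x (int m)]"] assms
    by (simp add: word_in_lists X_in_A)
  then show ?case using Suc assms
    by (simp add: skew_map_def shift_def m_assoc \<phi>_closed word_in_lists X_in_A algebra_simps)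
qed

section \<open>Injectivity, continuity, compactness and separation for the skew product\<close>

lemma skew_map_inj: "inj_on (skew_map G \<phi>) (topspace (skew_topology G A X))"
proof (rule inj_onI, clarsimp simp: topspace_skew skew_map_def)
  fix g x h y assume *: "g \<in> carrier G" "x \<in> X" "h \<in> carrier G" "y \<in> X"
    "g \<otimes> \<phi> [x 0] = h \<otimes> \<phi> [y 0]" "shift x = shift y"
  then have "x = y" using inj_shift by (metis injD)
  with * show "g = h \<and> x = y" using X_in_A \<phi>_closed[of "[x 0]"] by simp
qed

lemma skew_map_continuous:
  "continuous_map (skew_topology G A X) (skew_topology G A X) (skew_map G \<phi>)"
  unfolding continuous_map_def topspace_skew
proof (intro conjI allI impI)
  show "skew_map G \<phi> \<in> carrier G \<times> X \<rightarrow> carrier G \<times> X" using skew_map_in by blast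
  fix W assume W: "openin (skew_topology G A X) W"
  let ?V = "{p \<in> carrier G \<times> X. skew_map G \<phi> p \<in> W}"
  have "\<exists>N. \<forall>y\<in>X. agree N x y \<longrightarrow> (g, y) \<in> ?V" if gx: "(g, x) \<in> ?V" for g x
  proof -
    have "(g \<otimes> \<phi> [x 0], shift x) \<in> W" using gx by (simp add: skew_map_def)
    then obtain N where N: "\<forall>y\<in>X. agree N (shift x) y \<longrightarrow> (g \<otimes> \<phi> [x 0], y) \<in> W"
      using W unfolding openin_skew_iff[OF X_subset] by blast
    \<comment> \<open>The shift moves the window by one place, so radius \<open>Suc N\<close> for
      \<open>x\<close> covers radius \<open>N\<close> for \<open>shift x\<close>, and coordinate 0
      as well.\<close>
    have "(g, y) \<in> ?V" if y: "y \<in> X" "agree (Suc N) x y" for y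
    proof -
      have "x 0 = y 0" "agree N (shift x) (shift y)" using y(2) by (auto simp: agree_def shift_def)
      moreover have "shift y \<in> X" using y(1) shift_image by blast
      ultimately show ?thesis using N gx y(1) by (simp add: skew_map_def)
    qed
    then show ?thesis by blast
  qed
  then show "openin (skew_topology G A X) ?V" unfolding openin_skew_iff[OF X_subset] by blast
qed

lemma skew_compact: "compact_space (skew_topology G A X)"
proof -
  have "compact_space (full_shift A)"
    unfolding full_shift_def using finite_A
    by (simp add: compact_space_product_topology compact_space_discrete_topology)
  then have "compact_space (subtopology (full_shift A) X)"
    using minimal closedin_compact_space compact_space_subtopology
    unfolding minimal_shift_space_def shift_space_def by blast
  then show ?thesis
    unfolding skew_topology_def using finite_G
    by (simp add: compact_space_prod_topology compact_space_discrete_topology)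
qed

lemma skew_Hausdorff: "Hausdorff_space (skew_topology G A X)"
  unfolding skew_topology_def full_shift_def
  by (simp add: Hausdorff_space_prod_topology Hausdorff_space_subtopology
      Hausdorff_space_product_topology)

text \<open>The closure of the forward orbit of \<open>(\<one>, x)\<close> is evidently only mapped
  into itself, so minimality enters through \<open>minimal_system_iff_forward\<close>. The closure
  is then the whole space and the orbit meets every window around \<open>(g, y)\<close>.\<close>

lemma minimal_imp_forward_orbit_dense:
  assumes min: "minimal_system (skew_topology G A X) (skew_map G \<phi>)"
    and x: "x \<in> X" and g: "g \<in> carrier G" and y: "y \<in> X"
  shows "\<exists>m. \<phi> (word x 0 (int m)) = g \<and> agree N y (\<lambda>n. x (n + int m))"
proof -
  let ?U = "skew_topology G A X" and ?T = "skew_map G \<phi>"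
  define S where "S = range (\<lambda>m. (?T ^^ m) (\<one>, x))"
  have S_eq: "S = range (\<lambda>m. (\<phi> (word x 0 (int m)), \<lambda>n. x (n + int m)))"
    unfolding S_def using x by (simp add: funpow_skew_map \<phi>_closed word_in_lists)
  have S_sub: "S \<subseteq> topspace ?U"
    using x by (auto simp: S_eq topspace_skew \<phi>_closed word_in_lists translate_in_X)
  have "?T ` S \<subseteq> S"
  proof
    fix p assume "p \<in> ?T ` S"
    then obtain m where "p = (?T ^^ Suc m) (\<one>, x)" by (auto simp: S_def)
    then show "p \<in> S" unfolding S_def by blast
  qed
  then have "?T ` (?U closure_of S) \<subseteq> ?U closure_of S"
    using skew_map_continuous closure_of_mono unfolding continuous_map_eq_image_closure_subset
    by blast
  moreover have "?U closure_of S \<noteq> {}" using closure_of_subset[OF S_sub] by (auto simp: S_def)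
  ultimately have dense: "?U closure_of S = topspace ?U"
    using min closedin_closure_of
    unfolding minimal_system_iff_forward[OF skew_compact skew_Hausdorff skew_map_continuous skew_map_inj]
    by blast
  let ?W = "{g} \<times> {z \<in> X. agree N y z}"
  have "openin ?U ?W" unfolding openin_skew_iff[OF X_subset]
    using g by (auto simp: agree_def intro!: exI[of _ N])
  moreover have "(g, y) \<in> ?W" using y by (simp add: agree_refl)
  moreover have "(g, y) \<in> ?U closure_of S" using dense g y by (simp add: topspace_skew)
  ultimately obtain p where "p \<in> S" "p \<in> ?W" unfolding in_closure_of by meson
  then show ?thesis by (auto simp: S_eq)
qed

lemma minimal_imp_return_values:
  assumes "minimal_system (skew_topology G A X) (skew_map G \<phi>)" and x: "x \<in> X"
  shows "{\<phi> (word x 0 (int m)) | m::nat.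
           word x (int m) (int m + int n) = word x 0 (int n)} = carrier G"
proof (intro equalityI subsetI)
  fix g assume "g \<in> carrier G"
  then obtain m where m: "\<phi> (word x 0 (int m)) = g" "agree n x (\<lambda>k. x (k + int m))"
    using minimal_imp_forward_orbit_dense[OF assms(1) x _ x] by blast
  \<comment> \<open>The centred window of radius \<open>n\<close> contains the coordinates from 0 to
    \<open>n - 1\<close>; the form \<open>0 + int n\<close> lets \<open>word_eq_iff\<close>
    apply.\<close>
  have "word x (int m) (int m + int n) = word x 0 (0 + int n)"
    unfolding word_eq_iff using m(2) by (auto simp: agree_def add.commute)
  then show "g \<in> {\<phi> (word x 0 (int m)) | m::nat.
           word x (int m) (int m + int n) = word x 0 (int n)}" using m(1) by auto
qed (use x in \<open>auto simp: \<phi>_closed word_in_lists\<close>)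

section \<open>From return values to the submonoid generated by return words\<close>

lemma return_words_subset: "return_words X u \<subseteq> lists A"
proof
  fix r assume "r \<in> return_words X u"
  then obtain x i n where "x \<in> X" "r @ u = word x i (i + int n)"
    unfolding return_words_def by (blast elim: languageE)
  then have "r @ u \<in> lists A" by (simp add: word_in_lists)
  then show "r \<in> lists A" by simp
qed

lemma generated_subset: "submonoid_generated (free_monoid A) (return_words X u) \<subseteq> lists A"
  by (rule submonoid_generated_least[OF return_words_subset submonoid_lists])

lemma return_values_imp_generated:
  assumes ret: "\<And>n x. n > 0 \<Longrightarrow> x \<in> X \<Longrightarrow>
      {\<phi> (word x 0 (int m)) | m::nat. word x (int m) (int m + int n) = word x 0 (int n)} = carrier G"
    and u: "u \<in> language X"
  shows "\<phi> ` submonoid_generated (free_monoid A) (return_words X u) = carrier G"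
proof (intro equalityI subsetI)
  fix g assume g: "g \<in> carrier G"
  obtain y i n where y: "y \<in> X" "u = word y i (i + int n)" using u by (rule languageE)
  define x where "x = (\<lambda>k. y (k + i))"
  have x: "x \<in> X" unfolding x_def using y(1) by (rule translate_in_X)
  have ux: "word x 0 (0 + int n) = u"
    unfolding y(2) word_eq_iff by (simp add: x_def add.commute)
  \<comment> \<open>The hypothesis requires positive length while \<open>u\<close> may be empty,
    hence \<open>Suc n\<close>; a match of length \<open>Suc n\<close> contains one of length
    \<open>n\<close>.\<close>
  have "g \<in> {\<phi> (word x 0 (int m)) | m::nat.
      word x (int m) (int m + int (Suc n)) = word x 0 (int (Suc n))}"
    using ret[OF zero_less_Suc x, of n] g by blast
  then obtain m where m: "g = \<phi> (word x 0 (int m))"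
      "word x (int m) (int m + int (Suc n)) = word x 0 (0 + int (Suc n))" by auto
  have "word x (int m) (int m + int n) = word x 0 (0 + int n)"
    using m(2) unfolding word_eq_iff by simp
  then have "word x 0 (0 + int m) \<in> submonoid_generated (free_monoid A) (return_words X u)"
    using ux by (intro word_in_generated_return_words[OF x, of 0 n]) auto
  then show "g \<in> \<phi> ` submonoid_generated (free_monoid A) (return_words X u)" using m(1) by simp
qed (use generated_subset \<phi>_closed in blast)

end

section \<open>Fibers of an invariant closed set\<close>

locale invariant_closed_set = skew_product +
  fixes Y
  assumes closed: "closedin (skew_topology G A X) Y" and nonempty: "Y \<noteq> {}"
    and invariant: "skew_map G \<phi> ` Y = Y"
begin

definition fiber where "fiber x = {g. (g, x) \<in> Y}"

lemma Y_subset: "Y \<subseteq> carrier G \<times> X"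
  using closedin_subset[OF closed] by (simp add: topspace_skew)

lemma fiber_subset: "fiber x \<subseteq> carrier G"
  using Y_subset by (auto simp: fiber_def)

lemma finite_fiber: "finite (fiber x)"
  using finite_subset[OF fiber_subset finite_G] .

text \<open>Both inclusions in \<open>T(Y) = Y\<close> are used: a point of \<open>Y\<close> over
  \<open>shift x\<close> has a preimage in \<open>Y\<close>, which lies over \<open>x\<close>
  because the shift is injective.\<close>

lemma fiber_shift:
  assumes "x \<in> X" shows "fiber (shift x) = (\<lambda>g. g \<otimes> \<phi> [x 0]) ` fiber x"
proof (intro equalityI subsetI)
  fix h assume "h \<in> fiber (shift x)"
  then have "(h, shift x) \<in> skew_map G \<phi> ` Y" using invariant by (simp add: fiber_def)
  then obtain g y where gy: "(g, y) \<in> Y" "h = g \<otimes> \<phi> [y 0]" "shift y = shift x"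
    by (auto simp: skew_map_def)
  then have "y = x" using inj_shift by (metis injD)
  with gy show "h \<in> (\<lambda>g. g \<otimes> \<phi> [x 0]) ` fiber x" by (auto simp: fiber_def)
next
  fix h assume "h \<in> (\<lambda>g. g \<otimes> \<phi> [x 0]) ` fiber x"
  then obtain g where "(g, x) \<in> Y" "h = g \<otimes> \<phi> [x 0]" by (auto simp: fiber_def)
  then have "(h, shift x) \<in> skew_map G \<phi> ` Y" by (force simp: skew_map_def)
  then show "h \<in> fiber (shift x)" using invariant by (simp add: fiber_def)
qed

lemma fiber_translate:
  assumes x: "x \<in> X"
  shows "fiber (\<lambda>n. x (n + int m)) = (\<lambda>g. g \<otimes> \<phi> (word x 0 (int m))) ` fiber x"
proof (induction m)
  case 0
  have "(\<lambda>g. g \<otimes> \<one>) ` fiber x = (\<lambda>g. g) ` fiber x"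
    by (rule image_cong) (use fiber_subset[of x] in auto)
  then show ?case by (simp add: \<phi>_Nil)
next
  case (Suc m)
  have app: "\<phi> (word x 0 (int (Suc m))) = \<phi> (word x 0 (int m)) \<otimes> \<phi> [x (int m)]"
    using word_Suc[of x 0 m] \<phi>_append[of "word x 0 (int m)" "[x (int m)]"] x
    by (simp add: word_in_lists X_in_A)
  have "fiber (\<lambda>n. x (n + int (Suc m))) = fiber (shift (\<lambda>n. x (n + int m)))"
    by (simp add: shift_def algebra_simps)
  also have "\<dots> = (\<lambda>g. g \<otimes> \<phi> [x (int m)]) ` fiber (\<lambda>n. x (n + int m))"
    using fiber_shift[OF translate_in_X[OF x, of "int m"]] by simp
  also have "\<dots> = (\<lambda>g. g \<otimes> \<phi> (word x 0 (int (Suc m)))) ` fiber x"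
    unfolding Suc image_image app
    by (rule image_cong)
      (use x fiber_subset[of x] in \<open>auto simp: m_assoc \<phi>_closed word_in_lists X_in_A subset_iff\<close>)
  finally show ?case .
qed

lemma inj_on_mult_right: "h \<in> carrier G \<Longrightarrow> inj_on (\<lambda>g. g \<otimes> h) (carrier G)"
  by (auto intro: inj_onI)

lemma card_fiber_shift: "x \<in> X \<Longrightarrow> card (fiber (shift x)) = card (fiber x)"
  using fiber_shift inj_on_mult_right[of "\<phi> [x 0]"] fiber_subset[of x]
  by (metis Cons_in_lists_iff X_in_A \<phi>_closed card_image inj_on_subset lists.Nil)

text \<open>For each \<open>g\<close> outside the fiber, \<open>(g, x)\<close> has a window
  neighbourhood in the open complement of \<open>Y\<close>. There are finitely many such
  \<open>g\<close>, so one \<open>N\<close> bounds all the radii.\<close>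

lemma fiber_semicontinuous:
  assumes x: "x \<in> X"
  obtains N where "\<And>y. y \<in> X \<Longrightarrow> agree N x y \<Longrightarrow> fiber y \<subseteq> fiber x"
proof -
  have op: "openin (skew_topology G A X) (carrier G \<times> X - Y)"
    using closed by (simp add: closedin_def topspace_skew)
  have "\<forall>g\<in>carrier G - fiber x. \<exists>N. \<forall>y\<in>X. agree N x y \<longrightarrow> (g, y) \<notin> Y"
  proof
    fix g assume "g \<in> carrier G - fiber x"
    then have gx: "(g, x) \<in> carrier G \<times> X - Y" using x by (simp add: fiber_def)
    have "\<exists>N. \<forall>y\<in>X. agree N x y \<longrightarrow> (g, y) \<in> carrier G \<times> X - Y"
      using bspec[OF conjunct2[OF op[unfolded openin_skew_iff[OF X_subset]]] gx]
      unfolding case_prod_conv .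
    then show "\<exists>N. \<forall>y\<in>X. agree N x y \<longrightarrow> (g, y) \<notin> Y" by blast
  qed
  then obtain f where f: "\<forall>g\<in>carrier G - fiber x. \<forall>y\<in>X. agree (f g) x y \<longrightarrow> (g, y) \<notin> Y"
    by metis
  obtain N where N: "\<forall>k\<in>f ` (carrier G - fiber x). k \<le> N"
    using finite_nat_set_iff_bounded_le[of "f ` (carrier G - fiber x)"] finite_G by auto
  have "fiber y \<subseteq> fiber x" if "y \<in> X" "agree N x y" for y
  proof
    fix g assume g: "g \<in> fiber y"
    show "g \<in> fiber x"
    proof (rule ccontr)
      assume "g \<notin> fiber x"
      then have "g \<in> carrier G - fiber x" using g fiber_subset by blast
      with f N that agree_mono have "(g, y) \<notin> Y" by blast
      with g show False by (simp add: fiber_def)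
    qed
  qed
  then show thesis by (rule that)
qed

text \<open>The set \<open>D\<close> where the cardinality reaches its maximum is closed by
  semicontinuity and shift invariant, hence all of \<open>X\<close>. A point of \<open>Y\<close>
  shows that the constant is positive.\<close>

lemma card_fiber_constant:
  obtains k where "k > 0" "\<And>x. x \<in> X \<Longrightarrow> card (fiber x) = k"
proof -
  obtain g0 y0 where gy: "(g0, y0) \<in> Y" using nonempty by auto
  then have y0: "y0 \<in> X" using Y_subset by blast
  have bnd: "card (fiber x) < Suc (card (carrier G))" for x
    using card_mono[OF finite_G fiber_subset] by (simp add: less_Suc_eq_le)
  obtain x0 where x0: "x0 \<in> X" "\<And>x. x \<in> X \<Longrightarrow> card (fiber x) \<le> card (fiber x0)"
    using ex_has_greatest_nat[of "\<lambda>x. x \<in> X" y0 "\<lambda>x. card (fiber x)"] y0 bnd by blast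
  define k where "k = card (fiber x0)"
  define D where "D = {x \<in> X. k \<le> card (fiber x)}"
  \<comment> \<open>Near a point outside \<open>D\<close> the fibers lie in a fiber with fewer than
    \<open>k\<close> elements, so the complement of \<open>D\<close> is open.\<close>
  have "\<exists>N. \<forall>y\<in>X. agree N x y \<longrightarrow> y \<in> X - D" if x: "x \<in> X - D" for x
  proof -
    obtain N where N: "\<And>y. y \<in> X \<Longrightarrow> agree N x y \<Longrightarrow> fiber y \<subseteq> fiber x"
      using fiber_semicontinuous x by blast
    have "y \<in> X - D" if "y \<in> X" "agree N x y" for y
      using card_mono[OF finite_fiber N[OF that]] x that by (auto simp: D_def)
    then show ?thesis by blast
  qed
  then have "closedin (subtopology (full_shift A) X) D"
    unfolding closedin_def using openin_shift_space_iff[OF X_subset] X_subset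
    by (auto simp: D_def Int_absorb1)
  moreover have "shift ` D = D"
  proof (intro equalityI subsetI)
    fix y assume "y \<in> D"
    then obtain x where "x \<in> X" "y = shift x" using shift_image by (auto simp: D_def)
    with \<open>y \<in> D\<close> show "y \<in> shift ` D" by (auto simp: D_def card_fiber_shift)
  qed (use shift_image card_fiber_shift in \<open>auto simp: D_def\<close>)
  moreover have "x0 \<in> D" using x0(1) by (simp add: D_def k_def)
  ultimately have "D = topspace (subtopology (full_shift A) X)"
    using minimal unfolding minimal_shift_space_def minimal_system_def by blast
  then have "D = X" using X_subset by auto
  then have "card (fiber x) = k" if "x \<in> X" for x
    using x0(2)[OF that] that unfolding D_def k_def by (blast intro: le_antisym)
  moreover have "card (fiber y0) > 0"
    using gy finite_fiber by (auto simp: fiber_def card_gt_0_iff)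
  ultimately show thesis using that y0 by metis
qed

lemma fiber_constant_on_cylinder:
  obtains u Q where "u \<in> language X" "Q \<noteq> {}"
    "\<And>z. z \<in> X \<Longrightarrow> word z 0 (int (length u)) = u \<Longrightarrow> fiber z = Q"
proof -
  obtain k where k: "k > 0" "\<And>x. x \<in> X \<Longrightarrow> card (fiber x) = k" using card_fiber_constant by blast
  obtain x0 where x0: "x0 \<in> X" using nonempty Y_subset by fastforce
  obtain N where N: "\<And>y. y \<in> X \<Longrightarrow> agree N x0 y \<Longrightarrow> fiber y \<subseteq> fiber x0"
    using fiber_semicontinuous x0 by blast
  \<comment> \<open>Translating by \<open>N\<close> moves the centred window of \<open>x0\<close> to
    the positions 0 to \<open>2 * N\<close> of \<open>x\<close>, whence the length
    \<open>2 * N + 1\<close> of \<open>u\<close>.\<close>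
  define x where "x = (\<lambda>n. x0 (n + (- int N)))"
  have x: "x \<in> X" unfolding x_def using x0 by (rule translate_in_X)
  have x0_eq: "x0 = (\<lambda>n. x (n + int N))" by (simp add: x_def)
  define u where "u = word x 0 (0 + int (2 * N + 1))"
  have "fiber z = fiber x" if z: "z \<in> X" and zu: "word z 0 (int (length u)) = u" for z
  proof -
    have "length u = 2 * N + 1" unfolding u_def by (rule length_word)
    then have "word z 0 (0 + int (2 * N + 1)) = word x 0 (0 + int (2 * N + 1))"
      using zu by (simp add: u_def)
    then have zx: "z (int i) = x (int i)" if "i < 2 * N + 1" for i
      using that unfolding word_eq_iff by simp
    let ?y = "\<lambda>n. z (n + int N)"
    have "x0 i = ?y i" if "\<bar>i\<bar> \<le> int N" for i
    proof -
      have "nat (i + int N) < 2 * N + 1" "int (nat (i + int N)) = i + int N" using that by linarith+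
      then show ?thesis using zx[of "nat (i + int N)"] by (simp add: x0_eq)
    qed
    then have "fiber ?y \<subseteq> fiber x0" using N translate_in_X[OF z] by (simp add: agree_def)
    \<comment> \<open>Equal finite cardinalities turn the inclusion into an equality.\<close>
    then have eq: "fiber ?y = fiber x0"
      using card_subset_eq[OF finite_fiber] k(2) x0 translate_in_X[OF z] by metis
    \<comment> \<open>Moving back to the origin: the fibers of \<open>z\<close> and of
      \<open>x\<close> are both multiplied by the same \<open>?h\<close>, because their first
      \<open>N\<close> letters agree, and right multiplication cancels.\<close>
    let ?h = "\<phi> (word x 0 (int N))"
    have "word z 0 (0 + int N) = word x 0 (0 + int N)" unfolding word_eq_iff using zx by simp
    then have "(\<lambda>g. g \<otimes> ?h) ` fiber z = (\<lambda>g. g \<otimes> ?h) ` fiber x"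
      using eq fiber_translate[OF z, of N] fiber_translate[OF x, of N] x0_eq by simp
    moreover have "?h \<in> carrier G" using x by (simp add: \<phi>_closed word_in_lists)
    ultimately show ?thesis
      using inj_on_image_eq_iff[OF inj_on_mult_right] fiber_subset by metis
  qed
  moreover have "u \<in> language X" unfolding u_def by (rule language_word[OF x])
  moreover have "fiber x \<noteq> {}" using k x by fastforce
  ultimately show thesis using that by blast
qed

text \<open>Words whose image stabilises \<open>Q\<close> form a submonoid containing the return
  words to \<open>u\<close>. By the hypothesis their images exhaust the group, so the nonempty set
  \<open>Q\<close> is everything.\<close>

lemma eq_topspace:
  assumes gen: "\<And>u. u \<in> language X \<Longrightarrow>
      \<phi> ` submonoid_generated (free_monoid A) (return_words X u) = carrier G"
  shows "Y = topspace (skew_topology G A X)"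
proof -
  obtain u Q where u: "u \<in> language X" and Q: "Q \<noteq> {}"
    and cyl: "\<And>z. z \<in> X \<Longrightarrow> word z 0 (int (length u)) = u \<Longrightarrow> fiber z = Q"
    using fiber_constant_on_cylinder by blast
  obtain y i n where y: "y \<in> X" "u = word y i (i + int n)" using u by (rule languageE)
  have fib_u: "fiber (\<lambda>k. y (k + i)) = Q"
    by (rule cyl) (use y in \<open>auto simp: translate_in_X word_translate algebra_simps\<close>)
  then have Q_sub: "Q \<subseteq> carrier G" using fiber_subset by blast
  define H where "H = {w \<in> lists A. (\<lambda>g. g \<otimes> \<phi> w) ` Q = Q}"
  have "return_words X u \<subseteq> H"
  proof
    fix r assume r: "r \<in> return_words X u"
    then obtain z j m where z: "z \<in> X" "r @ u = word z j (j + int m)"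
      unfolding return_words_def by (blast elim: languageE)
    \<comment> \<open>\<open>x\<close> reads \<open>r @ u\<close> from the origin. As
      \<open>u\<close> occurs at 0 and at \<open>length r\<close>, both \<open>x\<close> and its
      translate by \<open>length r\<close> have fiber \<open>Q\<close>, while
      \<open>fiber_translate\<close> makes the second fiber the first times
      \<open>\<phi> r\<close>.\<close>
    define x where "x = (\<lambda>k. z (k + j))"
    have x: "x \<in> X" unfolding x_def using z(1) by (rule translate_in_X)
    have "m = length r + length u" using arg_cong[OF z(2), of length] by simp
    moreover have "word x 0 (int m) = r @ u"
      unfolding z(2) x_def word_translate by (simp add: add.commute)
    ultimately have xru: "word x 0 (0 + int (length r) + int (length u)) = r @ u" by simp
    then have xr: "word x 0 (int (length r)) = r"
      and xu: "word x (int (length r)) (int (length r) + int (length u)) = u"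
      using length_word[of x 0 "length r"] unfolding word_append[symmetric] by auto
    obtain s where "r @ u = u @ s" using r by (auto simp: return_words_def prefix_def)
    moreover have "r @ u = word x 0 (0 + int (length u) + int (length r))"
      using xru by (simp add: add.commute)
    ultimately have "word x 0 (int (length u)) = u"
      using length_word[of x 0 "length u"] unfolding word_append[symmetric] by auto
    then have "fiber x = Q" using cyl x by blast
    moreover have "fiber (\<lambda>k. x (k + int (length r))) = Q"
      by (rule cyl) (use xu x in \<open>auto simp: translate_in_X word_translate add.commute\<close>)
    ultimately have "(\<lambda>g. g \<otimes> \<phi> r) ` Q = Q" using fiber_translate[OF x, of "length r"] xr by simp
    then show "r \<in> H" using subsetD[OF return_words_subset r] unfolding H_def by blast
  qed
  moreover have "submonoid H (free_monoid A)"
  proof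
    show "H \<subseteq> carrier (free_monoid A)" by (auto simp: H_def free_monoid_def)
    show "\<one>\<^bsub>free_monoid A\<^esub> \<in> H"
      using Q_sub by (force simp: H_def free_monoid_def \<phi>_Nil)
    fix v w assume "v \<in> H" "w \<in> H"
    then have vw: "v \<in> lists A" "w \<in> lists A" "(\<lambda>g. g \<otimes> \<phi> v) ` Q = Q" "(\<lambda>g. g \<otimes> \<phi> w) ` Q = Q"
      by (simp_all add: H_def)
    have "(\<lambda>g. g \<otimes> \<phi> (v @ w)) ` Q = (\<lambda>g. g \<otimes> \<phi> w) ` (\<lambda>g. g \<otimes> \<phi> v) ` Q"
      unfolding image_image
      by (rule image_cong) (use vw Q_sub in \<open>auto simp: \<phi>_append m_assoc \<phi>_closed subset_iff\<close>)
    then show "v \<otimes>\<^bsub>free_monoid A\<^esub> w \<in> H" using vw by (simp add: H_def free_monoid_def)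
  qed
  ultimately have stab: "submonoid_generated (free_monoid A) (return_words X u) \<subseteq> H"
    by (rule submonoid_generated_least)
  have "carrier G \<subseteq> Q"
  proof
    fix g assume g: "g \<in> carrier G"
    obtain q where q: "q \<in> Q" using Q by blast
    have qG: "q \<in> carrier G" using q Q_sub by blast
    \<comment> \<open>This element carries \<open>q\<close> to \<open>g\<close> under right
      multiplication.\<close>
    have "inv q \<otimes> g \<in> \<phi> ` submonoid_generated (free_monoid A) (return_words X u)"
      unfolding gen[OF u] using g qG by simp
    then obtain w where w: "w \<in> H" "\<phi> w = inv q \<otimes> g" using stab by (metis imageE subsetD)
    then have "(\<lambda>g. g \<otimes> \<phi> w) ` Q = Q" by (simp add: H_def)
    then have "q \<otimes> \<phi> w \<in> Q" using q by blast
    then show "g \<in> Q" using g qG w(2) by (simp add: m_assoc[symmetric])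
  qed
  with Q_sub have "Q = carrier G" by simp
  \<comment> \<open>So far only fibers over the cylinder of \<open>u\<close> are known to be full;
    constant cardinality extends this to all of \<open>X\<close>.\<close>
  obtain k where k: "\<And>x. x \<in> X \<Longrightarrow> card (fiber x) = k" using card_fiber_constant by blast
  have "fiber x = carrier G" if "x \<in> X" for x
    using card_subset_eq[OF finite_G fiber_subset] k[OF that] k[OF translate_in_X[OF y(1)]]
      fib_u \<open>Q = carrier G\<close> by metis
  then have "carrier G \<times> X \<subseteq> Y" by (auto simp: fiber_def)
  then show ?thesis using Y_subset by (simp add: topspace_skew)
qed

end

lemma (in skew_product) generated_imp_minimal:
  assumes "\<And>u. u \<in> language X \<Longrightarrow>
      \<phi> ` submonoid_generated (free_monoid A) (return_words X u) = carrier G"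
  shows "minimal_system (skew_topology G A X) (skew_map G \<phi>)"
  unfolding minimal_system_def
proof (intro allI impI, elim conjE)
  fix Y assume "closedin (skew_topology G A X) Y" "Y \<noteq> {}" "skew_map G \<phi> ` Y = Y"
  then interpret invariant_closed_set G A X \<phi> Y by unfold_locales
  show "Y = topspace (skew_topology G A X)" using assms by (rule eq_topspace)
qed

theorem theorem6p1:
  fixes A :: "'a set" and X :: "(int \<Rightarrow> 'a) set"
    and G :: "('g, 'm) monoid_scheme" and \<phi> :: "'a list \<Rightarrow> 'g"
  assumes "finite A"
    and "minimal_shift_space A X"
    and "group G" and "finite (carrier G)"
    and "\<phi> \<in> epi (free_monoid A) G" and "\<phi> [] = \<one>\<^bsub>G\<^esub>"
  shows "((\<forall>n::nat. \<forall>x\<in>X. n > 0 \<longrightarrow>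
             {\<phi> (word x 0 (int m)) | m::nat.
                word x (int m) (int m + int n) = word x 0 (int n)} = carrier G)
          \<longleftrightarrow> minimal_system (skew_topology G A X) (skew_map G \<phi>))
       \<and> (minimal_system (skew_topology G A X) (skew_map G \<phi>)
          \<longleftrightarrow> (\<forall>u\<in>language X.
                 \<phi> ` submonoid_generated (free_monoid A) (return_words X u) = carrier G))"
    (is "(?i \<longleftrightarrow> ?ii) \<and> (_ \<longleftrightarrow> ?iii)")
proof -
  interpret group G by fact
  interpret skew_product G A X \<phi> using assms by unfold_locales
  have "?ii \<Longrightarrow> ?i" using minimal_imp_return_values by blast
  moreover have "?i \<Longrightarrow> ?iii" by (intro ballI return_values_imp_generated) auto
  moreover have "?iii \<Longrightarrow> ?ii" by (intro generated_imp_minimal) auto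
  ultimately show ?thesis by argo
qed

end
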